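(* Let $X$ and $S$ be independent random variables with $\mathsf{P}(X>0)=\mathsf{P}(S>0)=1$, $0<\mathsf{E}X<\infty$, $0<\mathsf{E}S<\infty$ and $\mathsf{P}(X>S)>0$. Consider the stationary GI/GI/1/1-PO (bufferless, preemptive push-out) server with i.i.d. interarrival times distributed as $X$ and i.i.d. service times distributed as $S$, independent of the arrival process. Then the stationary average relative age of information $\overline{\Delta}$ is $$\overline{\Delta}=\frac{\mathsf{E}(X\wedge S)}{\mathsf{P}(X>S)},$$ where $X\wedge S=\min\{X,S\}$.
   Context: GI/GI/1/1-PO server. Messages arrive at times $\cdots<T_{-1}<T_0\le 0<T_1<\cdots$, and message $n\in\mathbb{Z}$ has service time $S_n$. The server has no buffer. Each arriving message immediately starts service, and if another message is in service at that moment, that message is pushed out (preempted and lost forever). So message $n$ is successfully transmitted if and only if $S_n<T_{n+1}-T_n$. In that case it departs at time $T_n+S_n$; otherwise it never departs. Stationary version. The arrival process is the time-stationary renewal process with interarrival law that of $X$: the interval $T_1-T_0$ containing the origin has the length-biased law $x\,\mathsf{P}(X\in dx)/\mathsf{E}X$; $T_0=-U(T_1-T_0)$ with $U$ uniform on $[0,1]$ independent of everything else; the other interarrival times $T_{n+1}-T_n$, $n\neq 0$, are i.i.d. distributed as $X$ and independent of $(T_0,T_1)$. The service times $(S_n)_{n\in\mathbb{Z}}$ are i.i.d. distributed as $S$ and independent of the arrival process. Relative age of information. Let $A(t)$ be the largest message arrival time that is $\le t$, and let $D(t)$ be the largest departure time (of a successfully transmitted message) that is $\le t$. For this server, $A(D(t))$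 is the arrival time of the message that departs at time $D(t)$. Define $$\Delta(t)=A(t)-A(D(t))\ge 0,$$ so that $\Delta(t)=0$ exactly when the most recently arrived message has already been successfully transmitted by time $t$. The stationary average relative age of information is $\overline{\Delta}=\mathsf{E}[\Delta(t)]$, which does not depend on $t$ by stationarity. *)

theory Defs
  imports "HOL-Probability.Probability"
begin

text \<open>
  Path-wise description of the bufferless push-out server: \<open>T n\<close> is the arrival time and
  \<open>S n\<close> the service time of message \<open>n\<close>.
\<close>

definition transmitted :: "(int \<Rightarrow> real) \<Rightarrow> (int \<Rightarrow> real) \<Rightarrow> int \<Rightarrow> bool" where
  "transmitted T S n \<longleftrightarrow> S n < T (n + 1) - T n"

definition last_arrival :: "(int \<Rightarrow> real) \<Rightarrow> real \<Rightarrow> real" where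
  "last_arrival T t = (GREATEST s. s \<le> t \<and> (\<exists>n. s = T n))"

definition last_departure :: "(int \<Rightarrow> real) \<Rightarrow> (int \<Rightarrow> real) \<Rightarrow> real \<Rightarrow> real" where
  "last_departure T S t = (GREATEST s. s \<le> t \<and> (\<exists>n. transmitted T S n \<and> s = T n + S n))"

definition relative_age :: "(int \<Rightarrow> real) \<Rightarrow> (int \<Rightarrow> real) \<Rightarrow> real \<Rightarrow> real" where
  "relative_age T S t = last_arrival T t - last_arrival T (last_departure T S t)"

definition length_biased :: "real measure \<Rightarrow> real measure" where
  "length_biased F = density F (\<lambda>x. ennreal (x / (\<integral>y. y \<partial>F)))"

text \<open>
  \<open>F\<close> and \<open>G\<close> are the interarrival and service laws. The mutual independence in
  \<open>independent\<close> comprises all the independence requirements on the model: \<open>U\<close> is independent of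
  everything else, the intervals \<open>T (n + 1) - T n\<close> with \<open>n \<noteq> 0\<close> are independent of each other and
  of \<open>(T 0, T 1)\<close> (a function of \<open>U\<close> and \<open>T 1 - T 0\<close>), and the independent service times are
  independent of the arrival process. The ordering \<open>\<dots> < T (- 1) < T 0 \<le> 0 < T 1 < \<dots>\<close> is not
  assumed: when \<open>F\<close> is concentrated on the positive reals, it holds almost surely.
\<close>

locale stationary_push_out_server = prob_space M
  for M :: "'a measure" +
  fixes F G :: "real measure"
    and T S :: "int \<Rightarrow> 'a \<Rightarrow> real"
    and U :: "'a \<Rightarrow> real"
  assumes arrival_measurable: "\<And>n. random_variable borel (T n)"
    and independent:
      "indep_vars (\<lambda>_. borel)
         (case_sum (\<lambda>_::unit. U) (case_sum (\<lambda>n \<omega>. T (n + 1) \<omega> - T n \<omega>) S)) UNIV"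
    and uniform: "distr M borel U = uniform_measure lborel {0..1}"
    and interval_containing_origin:
      "distr M borel (\<lambda>\<omega>. T 1 \<omega> - T 0 \<omega>) = length_biased F"
    and first_arrival: "AE \<omega> in M. T 0 \<omega> = - U \<omega> * (T 1 \<omega> - T 0 \<omega>)"
    and interarrival: "\<And>n. n \<noteq> 0 \<Longrightarrow> distr M borel (\<lambda>\<omega>. T (n + 1) \<omega> - T n \<omega>) = F"
    and service: "\<And>n. distr M borel (S n) = G"

end

theory Submission imports Defs begin

text \<open>
  If message \<open>n\<close> is the last arrival before \<open>t\<close>, the relative age at \<open>t\<close> vanishes when \<open>n\<close> has departed
  by time \<open>t\<close>; otherwise it is the sum of the interarrival times going back from \<open>T n\<close> to the last
  transmitted message. The time-stationary law is the Palm law, under which the pairs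
  (interarrival time, service time) are i.i.d. and \<open>T 0 = 0\<close>, weighted by \<open>(T 1 - T 0) / E X\<close> and
  translated by a uniform point of \<open>[T 0, T 1)\<close>. Since the Palm law is invariant under shifts of the
  index, the expected age at \<open>t\<close> is the Palm expectation of the integral of the age over the cycle
  \<open>[T 0, T 1)\<close>, divided by \<open>E X\<close>. That integral is \<open>min (X, S)\<close> times the sum of the preceding
  interarrival times up to the last success, and this sum, independent of the cycle, has mean
  \<open>E X * (\<Sum>j. P(X \<le> S)^j) = E X / P(X > S)\<close>.
\<close>

section \<open>Paths\<close>

definition shift :: "int \<Rightarrow> (int \<Rightarrow> 'c) \<Rightarrow> int \<Rightarrow> 'c" where
  "shift n p = (\<lambda>k. p (n + k))"

text \<open>For \<open>n \<noteq> 0\<close> exactly one of the two index ranges is nonempty. The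
  result is the two-sided partial sum, that is, the arrival time of message \<open>n\<close> on a
  clock that starts when message 0 arrives.\<close>

definition arrival :: "(int \<Rightarrow> real \<times> real) \<Rightarrow> int \<Rightarrow> real" where
  "arrival p n = (\<Sum>k\<in>{0..<n}. fst (p k)) - (\<Sum>k\<in>{n..<0}. fst (p k))"

text \<open>
  The \<open>j\<close>-th term is the length of the \<open>(j + 1)\<close>-th interarrival time before message \<open>0\<close>, counted only
  if the \<open>j\<close> messages between that interval and message \<open>0\<close> were all pushed out.
\<close>

definition lost_run_term :: "(int \<Rightarrow> real \<times> real) \<Rightarrow> nat \<Rightarrow> ennreal" where
  "lost_run_term p j =
     ennreal (fst (p (- 1 - int j))) * (\<Prod>i<j. indicator {x. fst x \<le> snd x} (p (- 1 - int i)))"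

text \<open>Message 0 is the last arrival, \<open>r\<close> time units ago. The indicator says that
  its service is still unfinished, and the series is the time back to the latest earlier success.
  Values in \<open>ennreal\<close> allow the series to be formed on every path.\<close>

definition age_since_arrival :: "real \<Rightarrow> (int \<Rightarrow> real \<times> real) \<Rightarrow> ennreal" where
  "age_since_arrival r p = indicator {..<snd (p 0)} r * (\<Sum>j. lost_run_term p j)"

text \<open>These are the almost sure properties under which the \<open>GREATEST\<close> terms in
  the model are attained: every time lies in an interarrival interval, and some earlier message has
  departed.\<close>

definition regular :: "(int \<Rightarrow> real \<times> real) \<Rightarrow> bool" where
  "regular p \<longleftrightarrow> (\<forall>n. 0 < fst (p n) \<and> 0 < snd (p n)) \<and> (\<forall>n. \<exists>k<n. snd (p k) < fst (p k)) \<and>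
     (\<forall>t. (\<exists>n. t < arrival p n) \<and> (\<exists>n. arrival p n \<le> t))"

section \<open>Arrival times as two-sided partial sums\<close>

lemma int_rec_unique:
  fixes f g :: "int \<Rightarrow> real"
  assumes "f 0 = g 0" "\<And>n. f (n + 1) - f n = g (n + 1) - g n"
  shows "f n = g n"
proof (induction n rule: int_induct[where k=0])
  case base then show ?case by (rule assms)
next
  case (step1 i) then show ?case using assms(2)[of i] by simp
next
  case (step2 i) then show ?case using assms(2)[of "i - 1"] by simp
qed

lemma arrival_0 [simp]: "arrival p 0 = 0"
  by (simp add: arrival_def)

lemma arrival_Suc: "arrival p (n + 1) = arrival p n + fst (p n)"
proof (cases "n \<ge> 0")
  case True
  then have "{0..<n + 1} = insert n {0..<n}" by auto
  with True show ?thesis by (simp add: arrival_def)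
next
  case False
  then have "{n..<0} = insert n {n + 1..<0}" by auto
  with False show ?thesis by (simp add: arrival_def)
qed

lemma arrival_shift: "arrival (shift n p) k = arrival p (n + k) - arrival p n"
proof (rule int_rec_unique[where f="arrival (shift n p)" and g="\<lambda>k. arrival p (n + k) - arrival p n"])
  fix k
  show "arrival (shift n p) (k + 1) - arrival (shift n p) k =
      arrival p (n + (k + 1)) - arrival p n - (arrival p (n + k) - arrival p n)"
    using arrival_Suc[of p "n + k"] by (simp add: arrival_Suc shift_def add.assoc)
qed simp

lemma arrival_eq:
  assumes "\<And>n. fst (p n) = T (n + 1) - T n"
  shows "T n = T 0 + arrival p n"
proof -
  have "T n - T 0 = arrival p n"
    by (rule int_rec_unique) (simp_all add: arrival_Suc assms)
  then show ?thesis by simp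
qed

lemma strict_mono_int:
  fixes T :: "int \<Rightarrow> real"
  assumes "\<And>n. T n < T (n + 1)"
  shows "strict_mono T"
proof (rule strict_monoI)
  fix m n :: int assume "m < n"
  then show "T m < T n"
  proof (induction n rule: int_gr_induct)
    case base then show ?case by (rule assms)
  next
    case (step i) then show ?case using assms[of i] by simp
  qed
qed

section \<open>Last departure and relative age along a path\<close>

lemma last_arrival_eq:
  assumes "strict_mono T" "T n \<le> s" "s < T (n + 1)"
  shows "last_arrival T s = T n"
  unfolding last_arrival_def
proof (rule Greatest_equality)
  show "T n \<le> s \<and> (\<exists>m. T n = T m)" using assms by auto
  fix y assume "y \<le> s \<and> (\<exists>m. y = T m)"
  then obtain m where "y = T m" "T m < T (n + 1)" using assms by auto
  then show "y \<le> T n"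
    using strict_mono_less[OF assms(1)] strict_mono_less_eq[OF assms(1)] by auto
qed

text \<open>Departures follow the order of arrivals: a transmitted \<open>k < m\<close> leaves
  before \<open>T (k + 1) \<le> T m\<close>. Hence only messages after \<open>m\<close> have to be
  excluded by hypothesis.\<close>

lemma last_departure_eq:
  assumes T: "strict_mono T" and S: "\<And>k. 0 < S k"
    and m: "transmitted T S m" "T m + S m \<le> t"
    and later: "\<And>k. m < k \<Longrightarrow> transmitted T S k \<Longrightarrow> t < T k + S k"
  shows "last_departure T S t = T m + S m"
  unfolding last_departure_def
proof (rule Greatest_equality)
  show "T m + S m \<le> t \<and> (\<exists>n. transmitted T S n \<and> T m + S m = T n + S n)" using m by auto
  fix y assume "y \<le> t \<and> (\<exists>n. transmitted T S n \<and> y = T n + S n)"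
  then obtain k where k: "transmitted T S k" "y = T k + S k" "y \<le> t" by auto
  then have "k \<le> m" using later[of k] by force
  show "y \<le> T m + S m"
  proof (cases "k = m")
    case False
    with \<open>k \<le> m\<close> have "T (k + 1) \<le> T m" by (simp add: strict_mono_less_eq[OF T])
    then show ?thesis using k S[of m] by (auto simp: transmitted_def)
  qed (use k in simp)
qed

text \<open>The first success going back, at index \<open>- 1 - d\<close>, contributes a factor 0 to
  all terms beyond \<open>d\<close>. Term \<open>d\<close> itself survives, since its product stops
  at \<open>i < d\<close>; the remaining lengths telescope to the distance from that success to
  message 0.\<close>

lemma suminf_lost_run_term:
  assumes pos: "\<And>k. 0 \<le> fst (p k)"
    and d: "snd (p (- 1 - int d)) < fst (p (- 1 - int d))"
    and least: "\<And>i. i < d \<Longrightarrow> fst (p (- 1 - int i)) \<le> snd (p (- 1 - int i))"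
  shows "(\<Sum>j. lost_run_term p j) = ennreal (- arrival p (- 1 - int d))"
proof -
  have "(\<Sum>j. lost_run_term p j) = (\<Sum>j\<le>d. lost_run_term p j)"
  proof (rule suminf_finite)
    fix j assume "j \<notin> {..d}"
    then have "(\<Prod>i<j. indicator {x. fst x \<le> snd x} (p (- 1 - int i)) :: ennreal) = 0"
      using d by (intro prod_zero) (auto intro!: bexI[of _ d])
    then show "lost_run_term p j = 0" by (simp add: lost_run_term_def)
  qed simp
  also have "\<dots> = (\<Sum>j\<le>d. ennreal (fst (p (- 1 - int j))))"
    using least by (intro sum.cong) (auto simp: lost_run_term_def intro!: prod.neutral)
  also have "\<dots> = ennreal (\<Sum>j\<le>d. fst (p (- 1 - int j)))"
    using pos by simp
  also have "(\<Sum>j\<le>d. fst (p (- 1 - int j))) = - arrival p (- 1 - int d)"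
  proof (induction d)
    case 0 then show ?case using arrival_Suc[of p "-1"] by simp
  next
    case (Suc d)
    have "arrival p (- 1 - int d) = arrival p (- 2 - int d) + fst (p (- 2 - int d))"
      using arrival_Suc[of p "- 2 - int d"] by (simp add: algebra_simps)
    moreover have "- 1 - int (Suc d) = - 2 - int d" by simp
    ultimately show ?case using Suc by simp
  qed
  finally show ?thesis .
qed

lemma relative_age_eq:
  assumes p: "\<And>k. p k = (T (k + 1) - T k, S k)"
    and T: "\<And>k. T k < T (k + 1)" and S: "\<And>k. 0 < S k"
    and n: "T n \<le> t" "t < T (n + 1)"
    and success: "\<exists>k<n. transmitted T S k"
  shows "0 \<le> relative_age T S t"
    and "ennreal (relative_age T S t) = age_since_arrival (t - T n) (shift n p)"
proof -
  note mono = strict_mono_int[of T, OF T]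
  have T_next: "t < T k" if "n < k" for k
    using n that strict_mono_less_eq[OF mono, of "n + 1" k] by auto
  have la: "last_arrival T t = T n" by (rule last_arrival_eq[OF mono n])
  have "0 \<le> relative_age T S t \<and>
    ennreal (relative_age T S t) = age_since_arrival (t - T n) (shift n p)"
  proof (cases "T n + S n \<le> t")
    case True
    \<comment> \<open>Having departed by \<open>t\<close>, before the next arrival, message
      \<open>n\<close> cannot have been pushed out.\<close>
    have tr: "transmitted T S n" using True n by (simp add: transmitted_def)
    have "last_departure T S t = T n + S n"
    proof (rule last_departure_eq[OF mono S tr True])
      show "t < T k + S k" if "n < k" for k
        using T_next[OF that] S[of k] by linarith
    qed
    moreover have "last_arrival T (T n + S n) = T n"
      using S[of n] True n by (intro last_arrival_eq[OF mono]) auto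
    ultimately show ?thesis using True la
      by (simp add: relative_age_def age_since_arrival_def shift_def p)
  next
    case False
    define Q where "Q d \<longleftrightarrow> transmitted T S (n - 1 - int d)" for d
    obtain k where "k < n" "transmitted T S k" using success by auto
    then have "Q (nat (n - 1 - k))" by (simp add: Q_def)
    \<comment> \<open>Counting backwards from \<open>n - 1\<close> by a natural number turns the
      search for the latest success before \<open>n\<close> into a \<open>LEAST\<close>
      problem.\<close>
    define d where "d = (LEAST d. Q d)"
    define m where "m = n - 1 - int d"
    have Qd: "Q d" unfolding d_def by (rule LeastI) fact
    have least: "\<not> Q i" if "i < d" for i
      using that unfolding d_def by (rule not_less_Least)
    have tr: "transmitted T S m" using Qd by (simp add: Q_def m_def)
    have "T m + S m < T (m + 1)" using tr by (simp add: transmitted_def)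
    moreover have "T (m + 1) \<le> T n" by (simp add: m_def strict_mono_less_eq[OF mono])
    ultimately have le: "T m + S m \<le> t" and lt: "T m + S m < T (m + 1)" using n by auto
    have "last_departure T S t = T m + S m"
    proof (rule last_departure_eq[OF mono S tr le])
      fix k assume k: "m < k" "transmitted T S k"
      have "\<not> k < n"
      proof
        assume "k < n"
        then have "nat (n - 1 - k) < d" "n - 1 - int (nat (n - 1 - k)) = k"
          using k by (simp_all add: m_def nat_less_iff)
        then show False using least[of "nat (n - 1 - k)"] k by (simp add: Q_def)
      qed
      then consider "k = n" | "n < k" by linarith
      then show "t < T k + S k"
        using False T_next[of k] S[of k] by cases auto
    qed
    moreover have "last_arrival T (T m + S m) = T m"
      using S[of m] lt by (intro last_arrival_eq[OF mono]) auto
    ultimately have age: "relative_age T S t = T n - T m" by (simp add: relative_age_def la)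
    have mn: "T m \<le> T n" by (simp add: m_def strict_mono_less_eq[OF mono])
    have fp: "fst (p k) = T (k + 1) - T k" for k by (simp add: p)
    have "(\<Sum>j. lost_run_term (shift n p) j) = ennreal (- arrival (shift n p) (- 1 - int d))"
    proof (rule suminf_lost_run_term)
      show "0 \<le> fst (shift n p k)" for k
        using T[of "n + k"] by (simp add: shift_def p)
      show "snd (shift n p (- 1 - int d)) < fst (shift n p (- 1 - int d))"
        using Qd by (simp add: Q_def transmitted_def shift_def p algebra_simps)
      show "fst (shift n p (- 1 - int i)) \<le> snd (shift n p (- 1 - int i))" if "i < d" for i
        using least[OF that] by (simp add: Q_def transmitted_def shift_def p algebra_simps)
    qed
    also have "- arrival (shift n p) (- 1 - int d) = T n - T m"
      using arrival_eq[of p T n] arrival_eq[of p T m] fp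
      by (simp add: arrival_shift m_def algebra_simps)
    finally show ?thesis using False mn
      by (simp add: age age_since_arrival_def shift_def p)
  qed
  then show "0 \<le> relative_age T S t"
    and "ennreal (relative_age T S t) = age_since_arrival (t - T n) (shift n p)" by auto
qed

section \<open>The interarrival interval containing a given time\<close>

lemma arrival_interval_ex:
  fixes T :: "int \<Rightarrow> real"
  assumes T: "\<And>k. T k < T (k + 1)" and ub: "\<exists>k. t < T k" and lb: "\<exists>k. T k \<le> t"
  shows "\<exists>!n. T n \<le> t \<and> t < T (n + 1)"
proof (rule ex_ex1I)
  obtain l u where lu: "T l \<le> t" "t < T u" using ub lb by auto
  note mono = strict_mono_int[of T, OF T]
  have "l < u" using lu strict_mono_less[OF mono, of l u] by simp
  define d where "d = (LEAST d. t < T (l + int d))"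
  have ex: "t < T (l + int (nat (u - l)))" using lu \<open>l < u\<close> by simp
  have "t < T (l + int d)" unfolding d_def by (rule LeastI) (rule ex)
  \<comment> \<open>\<open>d\<close> is not 0 because \<open>T l \<le> t\<close>; its predecessor
    gives the last arrival up to \<open>t\<close>.\<close>
  then obtain e where e: "d = Suc e" using lu by (cases d) auto
  then have "\<not> t < T (l + int e)" unfolding d_def by (intro not_less_Least) simp
  with \<open>t < T (l + int d)\<close> e show "\<exists>n. T n \<le> t \<and> t < T (n + 1)"
    by (intro exI[of _ "l + int e"]) (simp add: algebra_simps)
  fix m n assume "T m \<le> t \<and> t < T (m + 1)" "T n \<le> t \<and> t < T (n + 1)"
  then have "T m < T (n + 1)" "T n < T (m + 1)" by linarith+
  then show "m = n" by (simp add: strict_mono_less[OF mono])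
qed

text \<open>Steps of size at least \<open>e\<close> recur in both directions and all other steps are
  positive, so \<open>j\<close> large steps lead at least \<open>j * e\<close> away from
  \<open>T 0\<close>; the Archimedean property concludes.\<close>

lemma steps_unbounded:
  fixes T :: "int \<Rightarrow> real"
  assumes T: "\<And>k. T k < T (k + 1)" and e: "0 < e"
    and up: "\<And>n. \<exists>k\<ge>n. e \<le> T (k + 1) - T k"
    and down: "\<And>n. \<exists>k\<le>n. e \<le> T (k + 1) - T k"
  shows "\<exists>k. t < T k" and "\<exists>k. T k \<le> t"
proof -
  note mono = strict_mono_less_eq[OF strict_mono_int[of T, OF T]]
  have up': "\<exists>k. T 0 + real j * e \<le> T k" for j
  proof (induction j)
    case (Suc j)
    then obtain n where n: "T 0 + real j * e \<le> T n" by auto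
    obtain k where k: "k \<ge> n" "e \<le> T (k + 1) - T k" using up by blast
    have "T n \<le> T k" using k by (simp add: mono)
    then show ?case using n k by (intro exI[of _ "k + 1"]) (simp add: algebra_simps)
  qed auto
  have down': "\<exists>k. T k \<le> T 0 - real j * e" for j
  proof (induction j)
    case (Suc j)
    then obtain n where n: "T n \<le> T 0 - real j * e" by auto
    obtain k where k: "k \<le> n - 1" "e \<le> T (k + 1) - T k" using down by blast
    have "T (k + 1) \<le> T n" using k by (simp add: mono)
    then show ?case using n k by (intro exI[of _ k]) (simp add: algebra_simps)
  qed auto
  obtain j where "t - T 0 < real j * e" using reals_Archimedean3[OF e] by blast
  then show "\<exists>k. t < T k" using up'[of j] by (auto intro: less_le_trans[rotated] simp: algebra_simps)
  obtain j where "T 0 - t < real j * e" using reals_Archimedean3[OF e] by blast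
  then show "\<exists>k. T k \<le> t" using down'[of j] by (metis diff_le_eq add.commute le_diff_eq less_imp_le order_trans)
qed

section \<open>Measurability of the age\<close>

text \<open>A greatest element, if there is one, is some \<open>a n\<close>, and the event that
  \<open>a n\<close> is maximal is a countable intersection. Measurability is needed on all of the
  space, including paths where no maximum exists.\<close>

lemma borel_measurable_Greatest_family:
  fixes a :: "int \<Rightarrow> 'a \<Rightarrow> real"
  assumes [measurable]: "\<And>n. a n \<in> borel_measurable M" "\<And>n. Measurable.pred M (P n)"
  shows "(\<lambda>\<omega>. GREATEST s. \<exists>n. P n \<omega> \<and> s = a n \<omega>) \<in> borel_measurable M"
proof (rule measurableI)
  define Q where "Q n \<omega> \<longleftrightarrow> P n \<omega> \<and> (\<forall>k. P k \<omega> \<longrightarrow> a k \<omega> \<le> a n \<omega>)" for n \<omega>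
  have [measurable]: "Measurable.pred M (Q n)" for n unfolding Q_def by measurable
  fix A :: "real set" assume [measurable]: "A \<in> sets borel"
  have *: "(GREATEST s. \<exists>n. P n \<omega> \<and> s = a n \<omega>) = a n \<omega>" if "Q n \<omega>" for n \<omega>
    using that by (intro Greatest_equality) (auto simp: Q_def)
  \<comment> \<open>If no greatest element exists, all these \<open>GREATEST\<close> terms denote the same junk value.\<close>
  have **: "(GREATEST s. \<exists>n. P n \<omega> \<and> s = a n \<omega>) = (THE x. False)" if "\<And>n. \<not> Q n \<omega>" for \<omega>
  proof -
    have "(\<exists>n. P n \<omega> \<and> x = a n \<omega>) \<and> (\<forall>y. (\<exists>n. P n \<omega> \<and> y = a n \<omega>) \<longrightarrow> y \<le> x) \<longleftrightarrow> False" for x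
      using that by (auto simp: Q_def)
    then show ?thesis unfolding Greatest_def by (simp only:)
  qed
  have "(\<lambda>\<omega>. GREATEST s. \<exists>n. P n \<omega> \<and> s = a n \<omega>) -` A \<inter> space M =
      {\<omega> \<in> space M. (\<exists>n. Q n \<omega> \<and> a n \<omega> \<in> A) \<or> ((\<forall>n. \<not> Q n \<omega>) \<and> (THE x. False) \<in> A)}"
  proof -
    have "(GREATEST s. \<exists>n. P n \<omega> \<and> s = a n \<omega>) \<in> A \<longleftrightarrow>
        (\<exists>n. Q n \<omega> \<and> a n \<omega> \<in> A) \<or> ((\<forall>n. \<not> Q n \<omega>) \<and> (THE x. False) \<in> A)" for \<omega>
    proof (cases "\<exists>n. Q n \<omega>")
      case True
      then obtain n where n: "Q n \<omega>" by (rule exE)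
      \<comment> \<open>Several indices may attain the maximum, but they share its value.\<close>
      have "a m \<omega> = a n \<omega>" if "Q m \<omega>" for m using *[OF n] *[OF that] by simp
      then show ?thesis unfolding *[OF n] using n by metis
    next
      case False
      then have no: "\<not> Q n \<omega>" for n by simp
      show ?thesis unfolding **[OF no] using no by simp
    qed
    then show ?thesis by auto
  qed
  also have "\<dots> \<in> sets M" by measurable
  finally show "(\<lambda>\<omega>. GREATEST s. \<exists>n. P n \<omega> \<and> s = a n \<omega>) -` A \<inter> space M \<in> sets M" .
qed simp

lemma borel_measurable_relative_age:
  assumes [measurable]: "\<And>n. T n \<in> borel_measurable M" "\<And>n. S n \<in> borel_measurable M"
  shows "(\<lambda>\<omega>. relative_age (\<lambda>n. T n \<omega>) (\<lambda>n. S n \<omega>) t) \<in> borel_measurable M"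
proof -
  have la: "(\<lambda>\<omega>. last_arrival (\<lambda>n. T n \<omega>) (f \<omega>)) \<in> borel_measurable M"
    if [measurable]: "f \<in> borel_measurable M" for f
  proof -
    have "last_arrival (\<lambda>n. T n \<omega>) (f \<omega>) = (GREATEST s. \<exists>n. T n \<omega> \<le> f \<omega> \<and> s = T n \<omega>)" for \<omega>
      unfolding last_arrival_def by (rule arg_cong[where f=Greatest]) auto
    then show ?thesis by (simp add: borel_measurable_Greatest_family)
  qed
  have ld: "(\<lambda>\<omega>. last_departure (\<lambda>n. T n \<omega>) (\<lambda>n. S n \<omega>) t) \<in> borel_measurable M"
  proof -
    have "last_departure (\<lambda>n. T n \<omega>) (\<lambda>n. S n \<omega>) t =
        (GREATEST s. \<exists>n. (S n \<omega> < T (n + 1) \<omega> - T n \<omega> \<and> T n \<omega> + S n \<omega> \<le> t) \<and> s = T n \<omega> + S n \<omega>)" for \<omega>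
      unfolding last_departure_def transmitted_def by (rule arg_cong[where f=Greatest]) auto
    then show ?thesis by (simp only:) (rule borel_measurable_Greatest_family; measurable)
  qed
  show ?thesis unfolding relative_age_def by (intro borel_measurable_diff la ld) simp
qed

section \<open>The Palm law\<close>

lemma sets_Collect_UNIV:
  assumes "Measurable.pred N P" "space N = UNIV"
  shows "{x. P x} \<in> sets N"
  using predE[OF assms(1)] assms(2) by simp

text \<open>\<open>H\<close> is the law of the pair (interarrival time, service time) of one
  message, later \<open>F \<Otimes>\<^sub>M G\<close>. The assumption \<open>success\<close> makes
  the geometric series over lost messages converge.\<close>

locale palm = prob_space H
  for H :: "(real \<times> real) measure" +
  assumes sets_H [measurable_cong, simp]: "sets H = sets (borel \<Otimes>\<^sub>M borel)"
    and pos: "AE x in H. 0 < fst x \<and> 0 < snd x"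
    and success: "0 < measure H {x. snd x < fst x}"
    and integrable_fst: "integrable H fst"
begin

definition P0 :: "(int \<Rightarrow> real \<times> real) measure" where
  "P0 = PiM UNIV (\<lambda>_. H)"

lemma space_H [simp]: "space H = UNIV"
  using sets_eq_imp_space_eq[OF sets_H] by (simp add: space_pair_measure)

lemma space_P0 [simp]: "space P0 = UNIV"
  by (simp add: P0_def space_PiM)

sublocale P0: product_prob_space "\<lambda>_::int. H" UNIV
  rewrites "PiM UNIV (\<lambda>_::int. H) \<equiv> P0"
  by unfold_locales (simp_all add: P0_def)

lemma measurable_coordinate: "(\<lambda>p. p n) \<in> measurable P0 (borel \<Otimes>\<^sub>M borel)"
proof -
  have "(\<lambda>p. p n) \<in> measurable P0 H" unfolding P0_def by measurable
  then show ?thesis by (simp cong: measurable_cong_sets)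
qed

lemma measurable_coordinate_app [measurable (raw)]:
  "f \<in> measurable N P0 \<Longrightarrow> (\<lambda>x. f x n) \<in> measurable N (borel \<Otimes>\<^sub>M borel)"
  using measurable_compose[OF _ measurable_coordinate] .

lemma measurable_into_P0:
  assumes "\<And>n. (\<lambda>x. f x n) \<in> measurable N (borel \<Otimes>\<^sub>M borel)"
  shows "f \<in> measurable N P0"
  unfolding P0_def
  by (rule measurable_PiM_single') (use assms in \<open>auto cong: measurable_cong_sets\<close>)

lemma measurable_shift [measurable]: "shift n \<in> measurable P0 P0"
  unfolding shift_def[abs_def] by (rule measurable_into_P0) measurable

text \<open>Translation of the index is an injective reindexing, which preserves a product of
  identical factors. This is the stationarity of the Palm law under a change of the reference
  message.\<close>

lemma distr_shift: "distr P0 P0 (shift n) = P0"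
proof -
  have "distr (PiM UNIV (\<lambda>_. H)) (\<Pi>\<^sub>M i\<in>UNIV. H) (\<lambda>p. \<lambda>k\<in>UNIV. p (n + k)) = (\<Pi>\<^sub>M i\<in>UNIV. H)"
    by (rule distr_PiM_reindex) (auto intro: prob_space_axioms)
  then show ?thesis by (simp add: P0_def shift_def[abs_def] restrict_def)
qed

lemma nn_integral_shift:
  assumes "f \<in> borel_measurable P0"
  shows "(\<integral>\<^sup>+p. f (shift n p) \<partial>P0) = (\<integral>\<^sup>+p. f p \<partial>P0)"
  using nn_integral_distr[of "shift n" P0 P0 f] assms by (simp add: distr_shift)

lemma measurable_arrival [measurable]: "(\<lambda>p. arrival p n) \<in> borel_measurable P0"
  unfolding arrival_def by measurable

lemma measurable_lost_run_term [measurable]: "(\<lambda>p. lost_run_term p j) \<in> borel_measurable P0"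
  unfolding lost_run_term_def by measurable

lemma measurable_age_since_arrival [measurable]:
  "(\<lambda>(r, p). age_since_arrival r p) \<in> borel_measurable (borel \<Otimes>\<^sub>M P0)"
proof -
  have "(\<lambda>x::real \<times> (int \<Rightarrow> real \<times> real). indicator {..<snd (snd x 0)} (fst x) :: ennreal) =
    (\<lambda>x. if fst x < snd (snd x 0) then 1 else 0)" by (auto simp: indicator_def)
  also have "\<dots> \<in> borel_measurable (borel \<Otimes>\<^sub>M P0)" by measurable
  finally have [measurable]: "(\<lambda>x. indicator {..<snd (snd x 0)} (fst x) :: ennreal)
    \<in> borel_measurable (borel \<Otimes>\<^sub>M P0)" .
  show ?thesis unfolding age_since_arrival_def split_beta by measurable
qed

lemma distr_coordinate: "distr P0 H (\<lambda>p. p n) = H"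
  using P0.PiM_component[of n] by (simp add: P0_def)

lemma AE_coordinate: "AE x in H. Q x \<Longrightarrow> AE p in P0. Q (p n)"
  unfolding P0_def by (rule AE_PiM_component) (auto intro: prob_space_axioms)

section \<open>Independence of the pairs and recurrence along a path\<close>

lemma indep_coordinates: "P0.P.indep_vars (\<lambda>_. H) (\<lambda>n p. p n) UNIV"
proof (subst P0.P.indep_vars_iff_distr_eq_PiM)
  show "distr P0 (Pi\<^sub>M UNIV (\<lambda>_. H)) (\<lambda>x. \<lambda>i\<in>UNIV. x i) =
    (\<Pi>\<^sub>M i\<in>UNIV. distr P0 H (\<lambda>p. p i))"
    by (simp add: distr_coordinate restrict_def flip: P0_def)
qed (auto cong: measurable_cong_sets)

lemma nn_integral_coordinates:
  assumes J: "finite J" and f: "\<And>n. n \<in> J \<Longrightarrow> f n \<in> borel_measurable (borel \<Otimes>\<^sub>M borel)"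
  shows "(\<integral>\<^sup>+p. (\<Prod>n\<in>J. f n (p n)) \<partial>P0) = (\<Prod>n\<in>J. \<integral>\<^sup>+x. f n x \<partial>H)"
proof -
  have "P0.P.indep_vars (\<lambda>_. borel) (\<lambda>n p. f n (p n)) J"
    by (rule P0.P.indep_vars_compose2[OF P0.P.indep_vars_subset[OF indep_coordinates subset_UNIV]])
       (use f in \<open>simp cong: measurable_cong_sets\<close>)
  then have "(\<integral>\<^sup>+p. (\<Prod>n\<in>J. f n (p n)) \<partial>P0) = (\<Prod>n\<in>J. \<integral>\<^sup>+p. f n (p n) \<partial>P0)"
    by (intro P0.P.indep_vars_nn_integral J) auto
  also have "\<dots> = (\<Prod>n\<in>J. \<integral>\<^sup>+x. f n x \<partial>distr P0 H (\<lambda>p. p n))"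
    using f by (intro prod.cong refl, subst nn_integral_distr) (auto cong: measurable_cong_sets)
  finally show ?thesis by (simp add: distr_coordinate)
qed

text \<open>Missing \<open>B\<close> along the whole sequence implies missing it at \<open>k\<close>
  coordinates, distinct because \<open>s\<close> is injective. By independence this has probability
  \<open>emeasure H (- B) ^ k\<close>, which tends to 0.\<close>

lemma AE_frequently:
  assumes [measurable]: "B \<in> sets (borel \<Otimes>\<^sub>M borel)" and B: "0 < measure H B"
    and s: "inj s"
  shows "AE p in P0. \<exists>i::nat. p (s i :: int) \<in> B"
proof -
  have [measurable]: "- B \<in> sets (borel \<Otimes>\<^sub>M borel)"
    using sets.compl_sets[of B H] by (simp add: Compl_eq_Diff_UNIV)
  have fin: "emeasure H (- B) < 1"
  proof -
    have "emeasure H (- B) = ennreal (1 - measure H B)"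
      using prob_compl[of B] by (simp add: emeasure_eq_measure Compl_eq_Diff_UNIV)
    then show ?thesis using B by (simp add: ennreal_less_one_iff)
  qed
  have le: "emeasure P0 {p. \<forall>i. p (s i) \<notin> B} \<le> emeasure H (- B) ^ k" for k
  proof -
    have "emeasure P0 {p. \<forall>i. p (s i) \<notin> B} = (\<integral>\<^sup>+p. indicator {p. \<forall>i. p (s i) \<notin> B} p \<partial>P0)"
      by (subst nn_integral_indicator) (auto intro!: sets_Collect_UNIV)
    also have "\<dots> \<le> (\<integral>\<^sup>+p. (\<Prod>n\<in>s ` {..<k}. indicator (- B) (p n)) \<partial>P0)"
      by (intro nn_integral_mono) (auto split: split_indicator intro!: prod_nonneg simp: prod.neutral)
    also have "\<dots> = (\<Prod>n\<in>s ` {..<k}. emeasure H (- B))"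
      by (subst nn_integral_coordinates) simp_all
    also have "\<dots> = emeasure H (- B) ^ k"
      using s by (simp add: card_image inj_on_subset[OF s])
    finally show ?thesis .
  qed
  have "(\<lambda>k. emeasure H (- B) ^ k) \<longlonglongrightarrow> 0"
  proof -
    have "(\<lambda>k. measure H (- B) ^ k) \<longlonglongrightarrow> 0"
      using fin by (intro LIMSEQ_power_zero) (simp add: emeasure_eq_measure ennreal_less_one_iff)
    then have "(\<lambda>k. ennreal (measure H (- B) ^ k)) \<longlonglongrightarrow> ennreal 0"
      by (rule tendsto_ennrealI)
    then show ?thesis by (simp add: emeasure_eq_measure ennreal_power)
  qed
  then have "emeasure P0 {p. \<forall>i. p (s i) \<notin> B} \<le> 0"
    using le by (intro tendsto_lowerbound[of _ _ sequentially]) auto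
  then show ?thesis by (intro AE_I[of _ _ "{p. \<forall>i. p (s i) \<notin> B}"]) (auto intro!: sets_Collect_UNIV)
qed

lemma AE_infinitely_often:
  assumes B: "B \<in> sets (borel \<Otimes>\<^sub>M borel)" "0 < measure H B"
  shows "AE p in P0. \<forall>n. (\<exists>k\<ge>n. p k \<in> B) \<and> (\<exists>k\<le>n. p k \<in> B)"
proof (rule AE_all_countable[THEN iffD2], rule allI, rule AE_conjI)
  fix n :: int
  have "AE p in P0. \<exists>i. p (n + int i) \<in> B" by (rule AE_frequently[OF B]) (auto intro: injI)
  then show "AE p in P0. \<exists>k\<ge>n. p k \<in> B"
    by eventually_elim (auto intro: exI[of _ "n + int _"])
  have "AE p in P0. \<exists>i. p (n - int i) \<in> B" by (rule AE_frequently[OF B]) (auto intro: injI)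
  then show "AE p in P0. \<exists>k\<le>n. p k \<in> B"
    by eventually_elim (auto intro: exI[of _ "n - int _"])
qed

text \<open>Interarrival times have no positive lower bound in general. If every level
  \<open>1 / Suc i\<close> were almost surely not reached, \<open>fst x\<close> could not be
  positive; so some level \<open>e\<close> serves as the recurring step size in
  \<open>steps_unbounded\<close>.\<close>

lemma large_step: "\<exists>e>0. 0 < measure H {x. e \<le> fst x}"
proof (rule ccontr)
  assume "\<not> ?thesis"
  then have 0: "measure H {x. e \<le> fst x} = 0" if "0 < e" for e
    using that by (metis measure_nonneg order_le_less)
  have "AE x in H. fst x < 1 / real (Suc i)" for i
    using 0[of "1 / real (Suc i)"]
    by (intro AE_I[of _ _ "{x. 1 / real (Suc i) \<le> fst x}"]) (auto simp: emeasure_eq_measure space_pair_measure intro!: sets_Collect_UNIV)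
  then have "AE x in H. \<forall>i. fst x < 1 / real (Suc i)" by (simp add: AE_all_countable)
  with pos have "AE x in H. False"
  proof eventually_elim
    case (elim x)
    then show False using nat_approx_posE[of "fst x"] by (metis less_asym inverse_eq_divide)
  qed
  then show False by simp
qed

lemma AE_regular:
  "AE p in P0. regular p"
proof -
  obtain e where e: "0 < e" "0 < measure H {x. e \<le> fst x}" using large_step by auto
  have "AE p in P0. \<forall>n. 0 < fst (p n) \<and> 0 < snd (p n)"
    using AE_coordinate[OF pos] by (simp add: AE_all_countable)
  moreover have "AE p in P0. \<forall>n. (\<exists>k\<ge>n. p k \<in> {x. snd x < fst x}) \<and> (\<exists>k\<le>n. p k \<in> {x. snd x < fst x})"
    by (rule AE_infinitely_often[OF _ success], rule sets_Collect_UNIV) (simp_all add: space_pair_measure)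
  moreover have "AE p in P0. \<forall>n. (\<exists>k\<ge>n. p k \<in> {x. e \<le> fst x}) \<and> (\<exists>k\<le>n. p k \<in> {x. e \<le> fst x})"
    by (rule AE_infinitely_often[OF _ e(2)], rule sets_Collect_UNIV) (simp_all add: space_pair_measure)
  ultimately show ?thesis
  proof eventually_elim
    case (elim p)
    have "\<exists>k<n. snd (p k) < fst (p k)" for n
    proof -
      \<comment> \<open>Recurrence is applied at \<open>n - 1\<close> to obtain an index strictly
        before \<open>n\<close>.\<close>
      obtain k where "k \<le> n - 1" "p k \<in> {x. snd x < fst x}" using elim(2) by blast
      then show ?thesis by (intro exI[of _ k]) auto
    qed
    moreover have "\<exists>n. t < arrival p n" "\<exists>n. arrival p n \<le> t" for t
      by (rule steps_unbounded[where T="arrival p" and e=e], use elim e in \<open>auto simp: arrival_Suc\<close>)+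
    ultimately show ?case unfolding regular_def using elim(1) by blast
  qed
qed

end

lemma nn_integral_count_space_single:
  fixes f :: "'i \<Rightarrow> ennreal"
  assumes "\<And>n. n \<noteq> k \<Longrightarrow> f n = 0"
  shows "(\<integral>\<^sup>+n. f n \<partial>count_space UNIV) = f k"
proof -
  have "(\<integral>\<^sup>+n. f n \<partial>count_space UNIV) = (\<integral>\<^sup>+n. f n * indicator {k} n \<partial>count_space UNIV)"
    using assms by (intro nn_integral_cong) (auto split: split_indicator)
  then show ?thesis by simp
qed

text \<open>Sums over messages are written as integrals over \<open>count_space UNIV\<close>. A
  countable index type makes the integrand jointly measurable.\<close>

lemma borel_measurable_nn_integral_count_space:
  fixes f :: "'i::countable \<Rightarrow> 'a \<Rightarrow> ennreal"
  assumes [measurable]: "\<And>n. f n \<in> borel_measurable M"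
  shows "(\<lambda>x. \<integral>\<^sup>+n. f n x \<partial>count_space UNIV) \<in> borel_measurable M"
proof -
  have [measurable]: "(\<lambda>(x, n). f n x) \<in> borel_measurable (M \<Otimes>\<^sub>M count_space UNIV)"
    unfolding split_beta
    by (rule measurable_compose_countable[where f="\<lambda>n x. f n (fst x)" and g=snd]) measurable
  interpret sigma_finite_measure "count_space (UNIV :: 'i set)"
    by (rule sigma_finite_measure_count_space)
  show ?thesis by (rule borel_measurable_nn_integral) measurable
qed

lemma arrival_intervals_cover:
  assumes "regular p"
  shows "\<exists>!n. arrival p n \<le> s \<and> s < arrival p (n + 1)"
  using assms by (intro arrival_interval_ex) (simp_all add: arrival_Suc regular_def)

lemma nn_integral_count_space_unique:
  fixes f :: "'i \<Rightarrow> ennreal"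
  assumes "\<exists>!n. P n" "P m"
  shows "(\<integral>\<^sup>+n. (if P n then f n else 0) \<partial>count_space UNIV) = f m"
proof -
  have "(\<integral>\<^sup>+n. (if P n then f n else 0) \<partial>count_space UNIV) = (if P m then f m else 0)"
    using assms by (intro nn_integral_count_space_single[of m]) auto
  then show ?thesis using assms(2) by simp
qed

section \<open>Integrals over one cycle under the Palm law\<close>

context palm
begin

text \<open>A mass transport argument: what the cycle of message 0, displaced by \<open>t\<close>,
  sends into the cycle of message \<open>n\<close> has the same mean as what the displaced cycle of
  message \<open>- n\<close> sends into the cycle of message 0. Summed over \<open>n\<close>, this
  removes \<open>t\<close>, which is the stationarity in time.\<close>

lemma cycle_formula:
  assumes g[measurable]: "(\<lambda>(r, p). g r p) \<in> borel_measurable (borel \<Otimes>\<^sub>M P0)"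
  shows "(\<integral>\<^sup>+p. \<integral>\<^sup>+v. (if 0 \<le> v \<and> v < fst (p 0) then
        (\<integral>\<^sup>+n. (if arrival p n \<le> t + v \<and> t + v < arrival p (n + 1)
           then g (t + v - arrival p n) (shift n p) else 0) \<partial>count_space UNIV) else 0) \<partial>lborel \<partial>P0)
    = (\<integral>\<^sup>+p. \<integral>\<^sup>+r. (if 0 \<le> r \<and> r < fst (p 0) then g r p else 0) \<partial>lborel \<partial>P0)"
proof -
  \<comment> \<open>\<open>K n\<close> is the part of the cycle shifted by \<open>t\<close> that lies in the \<open>n\<close>-th interval; seen from message
    \<open>n\<close> it becomes \<open>L n\<close>, and the domains of the \<open>L n\<close> partition the cycle.\<close>
  define K where "K n v p = (if 0 \<le> v \<and> v < fst (p 0) \<and> arrival p n \<le> t + v \<and> t + v < arrival p (n + 1)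
    then g (t + v - arrival p n) (shift n p) else 0)" for n v p
  define L where "L n r q = (if arrival q (- n) \<le> r - t \<and> r - t < arrival q (- n + 1) \<and>
    0 \<le> r \<and> r < fst (q 0) then g r q else 0)" for n r q
  have [measurable]: "(\<lambda>(v, p). K n v p) \<in> borel_measurable (borel \<Otimes>\<^sub>M P0)" for n
    unfolding K_def split_beta by measurable
  have [measurable]: "(\<lambda>(v, p). L n v p) \<in> borel_measurable (borel \<Otimes>\<^sub>M P0)" for n
    unfolding L_def split_beta by measurable
  \<comment> \<open>Message 0 of \<open>p\<close> has index \<open>- n\<close> in
    \<open>shift n p\<close>, so the two pairs of inequalities exchange their roles.\<close>
  have KL: "K n (arrival p n - t + r) p = L n r (shift n p)" for n r p
    using arrival_Suc[of p "-n"] arrival_Suc[of p n] arrival_shift[of n p "- n"] arrival_shift[of n p "-n + 1"]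
      arrival_Suc[of p 0]
    by (auto simp: K_def L_def shift_def algebra_simps)
  have "(\<integral>\<^sup>+p. \<integral>\<^sup>+v. (if 0 \<le> v \<and> v < fst (p 0) then
        (\<integral>\<^sup>+n. (if arrival p n \<le> t + v \<and> t + v < arrival p (n + 1)
           then g (t + v - arrival p n) (shift n p) else 0) \<partial>count_space UNIV) else 0) \<partial>lborel \<partial>P0)
    = (\<integral>\<^sup>+p. \<integral>\<^sup>+v. \<integral>\<^sup>+n. K n v p \<partial>count_space UNIV \<partial>lborel \<partial>P0)"
  proof (rule nn_integral_cong, rule nn_integral_cong)
    fix p v
    show "(if 0 \<le> v \<and> v < fst (p 0) then
        (\<integral>\<^sup>+n. (if arrival p n \<le> t + v \<and> t + v < arrival p (n + 1)
           then g (t + v - arrival p n) (shift n p) else 0) \<partial>count_space UNIV) else 0) =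
      (\<integral>\<^sup>+n. K n v p \<partial>count_space UNIV)"
    proof (cases "0 \<le> v \<and> v < fst (p 0)")
      case True then show ?thesis by (simp add: K_def)
    next
      case False
      then have "K n v p = 0" for n by (auto simp: K_def)
      then show ?thesis unfolding if_not_P[OF False] by simp
    qed
  qed
  also have "\<dots> = (\<integral>\<^sup>+p. \<integral>\<^sup>+n. \<integral>\<^sup>+v. K n v p \<partial>lborel \<partial>count_space UNIV \<partial>P0)"
    by (intro nn_integral_cong nn_integral_count_space_nn_integral) measurable
  also have "\<dots> = (\<integral>\<^sup>+n. \<integral>\<^sup>+p. \<integral>\<^sup>+v. K n v p \<partial>lborel \<partial>P0 \<partial>count_space UNIV)"
    by (intro nn_integral_count_space_nn_integral) measurable
  also have "\<dots> = (\<integral>\<^sup>+n. \<integral>\<^sup>+p. \<integral>\<^sup>+r. L n r (shift n p) \<partial>lborel \<partial>P0 \<partial>count_space UNIV)"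
  proof (rule nn_integral_cong, rule nn_integral_cong)
    fix n p
    show "(\<integral>\<^sup>+v. K n v p \<partial>lborel) = (\<integral>\<^sup>+r. L n r (shift n p) \<partial>lborel)"
      by (subst nn_integral_real_affine[where c=1 and t="arrival p n - t"]) (simp_all add: KL)
  qed
  also have "\<dots> = (\<integral>\<^sup>+n. \<integral>\<^sup>+q. \<integral>\<^sup>+r. L n r q \<partial>lborel \<partial>P0 \<partial>count_space UNIV)"
    by (rule nn_integral_cong, rule nn_integral_shift[where f="\<lambda>q. \<integral>\<^sup>+r. L _ r q \<partial>lborel"]) measurable
  also have "\<dots> = (\<integral>\<^sup>+q. \<integral>\<^sup>+n. \<integral>\<^sup>+r. L n r q \<partial>lborel \<partial>count_space UNIV \<partial>P0)"
    by (intro nn_integral_count_space_nn_integral[symmetric]) measurable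
  also have "\<dots> = (\<integral>\<^sup>+q. \<integral>\<^sup>+r. \<integral>\<^sup>+n. L n r q \<partial>count_space UNIV \<partial>lborel \<partial>P0)"
    by (intro nn_integral_cong nn_integral_count_space_nn_integral[symmetric]) measurable
  also have "\<dots> = (\<integral>\<^sup>+p. \<integral>\<^sup>+r. (if 0 \<le> r \<and> r < fst (p 0) then g r p else 0) \<partial>lborel \<partial>P0)"
  \<comment> \<open>Only this step uses regularity: \<open>r - t\<close> then lies in exactly one
    interval, say that of message \<open>m\<close>, and just the term with \<open>n = - m\<close>
    remains.\<close>
  proof (rule nn_integral_cong_AE, rule AE_mp[OF AE_regular], rule AE_I2, rule impI, rule nn_integral_cong)
    fix q r
    assume q: "regular q"
    note ex1 = arrival_intervals_cover[OF q, of "r - t"]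
    from ex1_implies_ex[OF ex1] obtain m where m: "arrival q m \<le> r - t \<and> r - t < arrival q (m + 1)"
      by (rule exE)
    have "(\<integral>\<^sup>+n. L n r q \<partial>count_space UNIV) = L (- m) r q"
    proof (rule nn_integral_count_space_single)
      fix n assume "n \<noteq> - m"
      then have "\<not> (arrival q (- n) \<le> r - t \<and> r - t < arrival q (- n + 1))"
        using ex1 m by (metis minus_equation_iff)
      then show "L n r q = 0" unfolding L_def by (intro if_not_P) blast
    qed
    then show "(\<integral>\<^sup>+n. L n r q \<partial>count_space UNIV) = (if 0 \<le> r \<and> r < fst (q 0) then g r q else 0)"
      using m by (simp add: L_def)
  qed
  finally show ?thesis .
qed

text \<open>The integrand factors over the distinct coordinates 0, \<open>- 1 - j\<close> and
  \<open>-1, ..., -j\<close>. The length counted in term \<open>j\<close> belongs to the message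
  beyond the \<open>j\<close> lost ones, so no indicator conditions it and its mean is that of an
  ordinary interarrival time.\<close>

lemma nn_integral_lost_run_term:
  "(\<integral>\<^sup>+p. ennreal (min (fst (p 0)) (snd (p 0))) * lost_run_term p j \<partial>P0) =
    (\<integral>\<^sup>+x. ennreal (min (fst x) (snd x)) \<partial>H) * (\<integral>\<^sup>+x. ennreal (fst x) \<partial>H) *
      emeasure H {x. fst x \<le> snd x} ^ j"
proof -
  define f :: "int \<Rightarrow> real \<times> real \<Rightarrow> ennreal" where
    "f n = (if n = 0 then (\<lambda>x. ennreal (min (fst x) (snd x)))
      else if n = - 1 - int j then (\<lambda>x. ennreal (fst x)) else indicator {x. fst x \<le> snd x})" for n
  define J where "J = insert 0 (insert (- 1 - int j) ((\<lambda>i. - 1 - int i) ` {..<j}))"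
  have J: "(\<Prod>n\<in>J. h n) = h 0 * (h (- 1 - int j) * (\<Prod>i<j. h (- 1 - int i)))" for h :: "int \<Rightarrow> ennreal"
  proof -
    have "(\<Prod>n\<in>(\<lambda>i. - 1 - int i) ` {..<j}. h n) = (\<Prod>i<j. h (- 1 - int i))"
      by (subst prod.reindex) (auto intro: inj_onI)
    then show ?thesis unfolding J_def by (subst prod.insert; auto)+
  qed
  have f: "f (- 1 - int i) = indicator {x. fst x \<le> snd x}" if "i < j" for i
    using that by (simp add: f_def)
  have [measurable]: "{x. fst x \<le> snd x} \<in> sets (borel \<Otimes>\<^sub>M borel :: (real \<times> real) measure)"
    by (rule sets_Collect_UNIV) (simp_all add: space_pair_measure)
  have "(\<integral>\<^sup>+p. ennreal (min (fst (p 0)) (snd (p 0))) * lost_run_term p j \<partial>P0) =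
      (\<integral>\<^sup>+p. (\<Prod>n\<in>J. f n (p n)) \<partial>P0)"
    unfolding J lost_run_term_def by (simp add: f) (simp add: f_def)
  also have "\<dots> = (\<Prod>n\<in>J. \<integral>\<^sup>+x. f n x \<partial>H)"
    by (rule nn_integral_coordinates) (auto simp: J_def f_def)
  also have "\<dots> = (\<integral>\<^sup>+x. ennreal (min (fst x) (snd x)) \<partial>H) * (\<integral>\<^sup>+x. ennreal (fst x) \<partial>H) *
      emeasure H {x. fst x \<le> snd x} ^ j"
    unfolding J by (simp add: f) (simp add: f_def mult.assoc)
  finally show ?thesis .
qed

lemma nn_integral_age_over_cycle:
  "(\<integral>\<^sup>+p. \<integral>\<^sup>+r. (if 0 \<le> r \<and> r < fst (p 0) then age_since_arrival r p else 0) \<partial>lborel \<partial>P0) =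
    ennreal ((\<integral>x. min (fst x) (snd x) \<partial>H) * (\<integral>x. fst x \<partial>H) / measure H {x. snd x < fst x})"
proof -
  have [measurable]: "{x. fst x \<le> snd x} \<in> sets (borel \<Otimes>\<^sub>M borel :: (real \<times> real) measure)"
    "{x. snd x < fst x} \<in> sets (borel \<Otimes>\<^sub>M borel :: (real \<times> real) measure)"
    by (rule sets_Collect_UNIV; simp add: space_pair_measure)+
  have [measurable]: "fst \<in> borel_measurable H" "snd \<in> borel_measurable H"
    by (simp_all cong: measurable_cong_sets)
  have inner: "(\<integral>\<^sup>+r. (if 0 \<le> r \<and> r < fst (p 0) then age_since_arrival r p else 0) \<partial>lborel) =
      (\<Sum>j. ennreal (min (fst (p 0)) (snd (p 0))) * lost_run_term p j)"
    if "0 < fst (p 0) \<and> 0 < snd (p 0)" for p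
  proof -
    have "(\<integral>\<^sup>+r. (if 0 \<le> r \<and> r < fst (p 0) then age_since_arrival r p else 0) \<partial>lborel) =
        (\<integral>\<^sup>+r. (\<Sum>j. lost_run_term p j) * indicator {0..<min (fst (p 0)) (snd (p 0))} r \<partial>lborel)"
      by (intro nn_integral_cong) (auto simp: age_since_arrival_def split: split_indicator)
    also have "\<dots> = (\<Sum>j. lost_run_term p j) * ennreal (min (fst (p 0)) (snd (p 0)))"
      using that by (subst nn_integral_cmult_indicator) auto
    finally show ?thesis by (simp add: mult.commute)
  qed
  have q: "measure H {x. fst x \<le> snd x} = 1 - measure H {x. snd x < fst x}"
    using prob_compl[of "{x. snd x < fst x}"] by (simp add: Compl_eq_Diff_UNIV[symmetric] Collect_neg_eq[symmetric] not_less)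
  have m: "(\<integral>\<^sup>+x. ennreal (fst x) \<partial>H) = ennreal (\<integral>x. fst x \<partial>H)"
    using pos by (intro nn_integral_eq_integral integrable_fst) auto
  have "integrable H (\<lambda>x. min (fst x) (snd x))"
    using pos by (intro Bochner_Integration.integrable_bound[OF integrable_fst]) auto
  then have mn: "(\<integral>\<^sup>+x. ennreal (min (fst x) (snd x)) \<partial>H) = ennreal (\<integral>x. min (fst x) (snd x) \<partial>H)"
    using pos by (intro nn_integral_eq_integral) auto
  have nonneg: "0 \<le> (\<integral>x. min (fst x) (snd x) \<partial>H)" "0 \<le> (\<integral>x. fst x \<partial>H)"
    using pos by (auto intro!: integral_nonneg_AE)
  have geom: "(\<Sum>j. emeasure H {x. fst x \<le> snd x} ^ j) = ennreal (1 / measure H {x. snd x < fst x})"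
  proof -
    \<comment> \<open>Positive success probability puts the ratio below 1.\<close>
    have *: "norm (measure H {x. fst x \<le> snd x}) < 1" using success q by simp
    have "(\<Sum>j. emeasure H {x. fst x \<le> snd x} ^ j) = (\<Sum>j. ennreal (measure H {x. fst x \<le> snd x} ^ j))"
      by (simp add: emeasure_eq_measure ennreal_power)
    also have "\<dots> = ennreal (\<Sum>j. measure H {x. fst x \<le> snd x} ^ j)"
      using * by (intro suminf_ennreal2 summable_geometric) auto
    finally show ?thesis using suminf_geometric[OF *] by (simp add: q)
  qed
  have "(\<integral>\<^sup>+p. \<integral>\<^sup>+r. (if 0 \<le> r \<and> r < fst (p 0) then age_since_arrival r p else 0) \<partial>lborel \<partial>P0) =
      (\<integral>\<^sup>+p. (\<Sum>j. ennreal (min (fst (p 0)) (snd (p 0))) * lost_run_term p j) \<partial>P0)"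
    using AE_coordinate[OF pos, of 0] inner by (intro nn_integral_cong_AE) auto
  also have "\<dots> = (\<Sum>j. \<integral>\<^sup>+p. ennreal (min (fst (p 0)) (snd (p 0))) * lost_run_term p j \<partial>P0)"
    by (rule nn_integral_suminf) measurable
  also have "\<dots> = (\<integral>\<^sup>+x. ennreal (min (fst x) (snd x)) \<partial>H) * (\<integral>\<^sup>+x. ennreal (fst x) \<partial>H) *
      (\<Sum>j. emeasure H {x. fst x \<le> snd x} ^ j)"
    by (simp add: nn_integral_lost_run_term)
  also have "\<dots> = ennreal ((\<integral>x. min (fst x) (snd x) \<partial>H) * (\<integral>x. fst x \<partial>H) / measure H {x. snd x < fst x})"
    unfolding m mn geom using nonneg by (simp flip: ennreal_mult')
  finally show ?thesis .
qed

end

section \<open>The stationary law\<close>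

text \<open>Reweighting one coordinate by a probability density changes only that factor of the
  product, as finite-dimensional cylinders show. It expresses the length bias of the interval at the
  origin as a density with respect to the Palm law.\<close>

lemma (in palm) density_PiM_coordinate:
  assumes w [measurable]: "w \<in> borel_measurable (borel \<Otimes>\<^sub>M borel)"
    and w1: "(\<integral>\<^sup>+x. w x \<partial>H) = 1"
  shows "PiM UNIV (\<lambda>n. if n = 0 then density H w else H) = density P0 (\<lambda>p. w (p 0))"
proof -
  define K where "K n = (if n = 0 then density H w else H)" for n :: int
  have "emeasure (density H w) (space H) = 1"
    using w1 by (subst emeasure_density) (auto simp del: sets_H space_H simp: measurable_cong_sets[OF sets_H refl])
  then have "prob_space (K n)" for n
    using prob_space_axioms by (auto simp: K_def simp del: space_H intro!: prob_spaceI)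
  then interpret K: product_prob_space K UNIV
    by (rule product_prob_spaceI)
  have sets_K: "sets (K n) = sets (borel \<Otimes>\<^sub>M borel)" for n by (simp add: K_def)
  have "density P0 (\<lambda>p. w (p 0)) = PiM UNIV K"
  proof (rule K.PiM_eq)
    show "sets (density P0 (\<lambda>p. w (p 0))) = sets (PiM UNIV K)"
      unfolding P0_def sets_density by (rule sets_PiM_cong) (simp_all add: sets_K)
  next
    fix J and E :: "int \<Rightarrow> (real \<times> real) set"
    assume J: "finite J" and E: "\<And>j. j \<in> J \<Longrightarrow> E j \<in> sets (K j)"
    define f where "f n x = (if n = 0 then w x else 1) * (if n \<in> J then indicator (E n) x else 1)" for n x
    have [measurable]: "f n \<in> borel_measurable (borel \<Otimes>\<^sub>M borel)" for n
      using E[of n] by (cases "n = 0"; cases "n \<in> J") (simp_all add: f_def[abs_def] sets_K)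
    have emb: "prod_emb UNIV K J (PiE J E) = {p. \<forall>j\<in>J. p j \<in> E j}"
      using sets_eq_imp_space_eq[OF sets_K] by (auto simp: prod_emb_def space_pair_measure PiE_def Pi_def)
    have meas: "{p. \<forall>j\<in>J. p j \<in> E j} \<in> sets P0"
      using J E by (intro sets_Collect_UNIV) (auto simp: sets_K intro!: pred_intros_finite)
    have "emeasure (density P0 (\<lambda>p. w (p 0))) (prod_emb UNIV K J (PiE J E)) =
        (\<integral>\<^sup>+p. w (p 0) * indicator {p. \<forall>j\<in>J. p j \<in> E j} p \<partial>P0)"
      unfolding emb using meas by (subst emeasure_density) auto
    \<comment> \<open>Coordinate 0 carries the weight even when the cylinder does not constrain it;
      in that case its factor integrates to 1.\<close>
    also have "\<dots> = (\<integral>\<^sup>+p. (\<Prod>n\<in>insert 0 J. f n (p n)) \<partial>P0)"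
    proof (rule nn_integral_cong)
      fix p
      have "(\<Prod>n\<in>insert 0 J. f n (p n)) =
          (\<Prod>n\<in>insert 0 J. if n = 0 then w (p n) else 1) * (\<Prod>n\<in>insert 0 J. if n \<in> J then indicator (E n) (p n) else 1)"
        unfolding f_def by (rule prod.distrib)
      also have "(\<Prod>n\<in>insert 0 J. if n = 0 then w (p n) else 1) = w (p 0)"
        using J by (subst prod.delta) auto
      also have "(\<Prod>n\<in>insert 0 J. if n \<in> J then indicator (E n) (p n) else (1::ennreal)) = (\<Prod>n\<in>J. indicator (E n) (p n))"
        using J by (intro prod.mono_neutral_cong_right) auto
      also have "\<dots> = indicator {p. \<forall>j\<in>J. p j \<in> E j} p"
        using J by (auto split: split_indicator)
      finally show "w (p 0) * indicator {p. \<forall>j\<in>J. p j \<in> E j} p = (\<Prod>n\<in>insert 0 J. f n (p n))" by simp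
    qed
    also have "\<dots> = (\<Prod>n\<in>insert 0 J. \<integral>\<^sup>+x. f n x \<partial>H)"
      using J by (intro nn_integral_coordinates) auto
    also have "\<dots> = (\<Prod>n\<in>J. emeasure (K n) (E n))"
    proof (rule prod.mono_neutral_cong_right)
      show "\<forall>n\<in>insert 0 J - J. (\<integral>\<^sup>+x. f n x \<partial>H) = 1" using w1 by (auto simp: f_def)
      show "(\<integral>\<^sup>+x. f n x \<partial>H) = emeasure (K n) (E n)" if "n \<in> J" for n
        using E[OF that] that by (auto simp: f_def K_def emeasure_density cong: measurable_cong_sets)
    qed (use J in auto)
    finally show "emeasure (density P0 (\<lambda>p. w (p 0))) (prod_emb UNIV K J (PiE J E)) =
      (\<Prod>n\<in>J. emeasure (K n) (E n))" .
  qed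
  then show ?thesis unfolding K_def by simp
qed

section \<open>The stationary server under the hypotheses on its marginal laws\<close>

locale regular_push_out_server =
  stationary_push_out_server M F G T S U + H: palm "F \<Otimes>\<^sub>M G"
  for M :: "'a measure" and F G T S U
begin

definition marks :: "'a \<Rightarrow> int \<Rightarrow> real \<times> real" where
  "marks \<omega> n = (T (n + 1) \<omega> - T n \<omega>, S n \<omega>)"

definition mean :: real where
  "mean = (\<integral>x. x \<partial>F)"

lemma measurable_T [measurable]: "T n \<in> borel_measurable M"
  by (rule arrival_measurable)

lemma measurable_S [measurable]: "S n \<in> borel_measurable M"
  using independent unfolding indep_vars_def by (auto dest: spec[of _ "Inr (Inr n)"])

lemma measurable_U [measurable]: "U \<in> borel_measurable M"
  using independent unfolding indep_vars_def by (auto dest: spec[of _ "Inl ()"])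

text \<open>Reading \<open>F\<close> as the law of an interval away from the origin shows that it is
  a Borel probability measure.\<close>

lemma F_eq: "F = distr M borel (\<lambda>\<omega>. T 2 \<omega> - T 1 \<omega>)"
  using interarrival[of 1] by simp

lemma sets_F [simp, measurable_cong]: "sets F = sets borel"
  by (simp add: F_eq)

lemma sets_G [simp, measurable_cong]: "sets G = sets borel"
  using service[of 0] by (metis sets_distr)

lemma prob_space_F: "prob_space F"
  unfolding F_eq by (rule prob_space_distr) simp

lemma prob_space_G: "prob_space G"
  using service[of 0] prob_space_distr[OF measurable_S, of 0] by simp

lemma measurable_marks [measurable]: "marks \<in> measurable M H.P0"
  by (rule H.measurable_into_P0) (simp add: marks_def)

lemma mean_eq: "mean = (\<integral>x. fst x \<partial>(F \<Otimes>\<^sub>M G))"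
proof -
  interpret F: prob_space F by (rule prob_space_F)
  interpret G: prob_space G by (rule prob_space_G)
  have "distr (F \<Otimes>\<^sub>M G) F fst = F"
    by (rule G.distr_pair_fst)
  moreover have "fst \<in> measurable (F \<Otimes>\<^sub>M G) F" by simp
  ultimately show ?thesis
    using integral_distr[of fst "F \<Otimes>\<^sub>M G" F "\<lambda>x. x"]
    by (simp add: mean_def)
qed

lemma mean_pos: "0 < mean"
proof -
  have "mean \<noteq> 0"
  proof
    assume "mean = 0"
    then have "AE x in F \<Otimes>\<^sub>M G. fst x = 0"
      using H.pos H.integrable_fst by (subst integral_nonneg_eq_0_iff_AE[symmetric]) (auto simp: mean_eq)
    with H.pos have "AE x in F \<Otimes>\<^sub>M G. False" by eventually_elim auto
    then show False by simp
  qed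
  moreover have "0 \<le> mean" unfolding mean_eq using H.pos by (intro integral_nonneg_AE) auto
  ultimately show ?thesis by simp
qed

abbreviation bias :: "real \<times> real \<Rightarrow> ennreal" where
  "bias x \<equiv> ennreal (fst x / mean)"

lemma distr_pair_marks:
  "distr M (borel \<Otimes>\<^sub>M borel) (\<lambda>\<omega>. marks \<omega> n) =
    (if n = 0 then density (F \<Otimes>\<^sub>M G) bias else F \<Otimes>\<^sub>M G)"
proof -
  let ?V = "case_sum (\<lambda>_::unit. U) (case_sum (\<lambda>n \<omega>. T (n + 1) \<omega> - T n \<omega>) S)"
  have "indep_var (PiM {Inr (Inl n)} (\<lambda>_. borel)) (\<lambda>\<omega>. restrict (\<lambda>i. ?V i \<omega>) {Inr (Inl n)})
      (PiM {Inr (Inr n)} (\<lambda>_. borel)) (\<lambda>\<omega>. restrict (\<lambda>i. ?V i \<omega>) {Inr (Inr n)})"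
    by (rule indep_var_restrict[OF independent]) auto
  from indep_var_compose[OF this, of "\<lambda>f. f (Inr (Inl n))" borel "\<lambda>f. f (Inr (Inr n))" borel]
  have "indep_var borel (\<lambda>\<omega>. T (n + 1) \<omega> - T n \<omega>) borel (S n)"
    by (simp add: comp_def)
  then have *: "distr M (borel \<Otimes>\<^sub>M borel) (\<lambda>\<omega>. marks \<omega> n) =
      distr M borel (\<lambda>\<omega>. T (n + 1) \<omega> - T n \<omega>) \<Otimes>\<^sub>M G"
    unfolding indep_var_distribution_eq marks_def service by simp
  interpret F: prob_space F by (rule prob_space_F)
  interpret G: prob_space G by (rule prob_space_G)
  show ?thesis
  proof (cases "n = 0")
    case True
    \<comment> \<open>\<open>G\<close> is written with density 1 so that the rule for products of
      densities applies.\<close>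
    have "length_biased F \<Otimes>\<^sub>M G = density F (\<lambda>x. ennreal (x / mean)) \<Otimes>\<^sub>M density G (\<lambda>_. 1)"
      by (simp add: length_biased_def mean_def density_1)
    also have "\<dots> = density (F \<Otimes>\<^sub>M G) (\<lambda>(x, y). ennreal (x / mean) * 1)"
      by (rule pair_measure_density) (auto simp: density_1 intro: G.sigma_finite_measure_axioms F.sigma_finite_measure_axioms)
    finally show ?thesis using True * interval_containing_origin by (simp add: split_beta')
  next
    case False
    then show ?thesis using * interarrival[of n] by simp
  qed
qed

lemma nn_integral_bias: "(\<integral>\<^sup>+x. bias x \<partial>(F \<Otimes>\<^sub>M G)) = 1"
proof -
  have "(\<integral>\<^sup>+x. bias x \<partial>(F \<Otimes>\<^sub>M G)) = ennreal (\<integral>x. fst x / mean \<partial>(F \<Otimes>\<^sub>M G))"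
    using H.pos mean_pos H.integrable_fst by (intro nn_integral_eq_integral) auto
  then show ?thesis using mean_pos by (simp flip: mean_eq)
qed

text \<open>The index blocks consisting of interval \<open>n\<close> and service time
  \<open>n\<close> are disjoint, so the marks are independent. Only the factor at 0 differs from the
  Palm law, by its length bias.\<close>

lemma distr_marks: "distr M H.P0 marks = density H.P0 (\<lambda>p. bias (p 0))"
proof -
  let ?V = "case_sum (\<lambda>_::unit. U) (case_sum (\<lambda>n \<omega>. T (n + 1) \<omega> - T n \<omega>) S)"
  define K where "K n = {Inr (Inl n), Inr (Inr n) :: unit + int + int}" for n
  have "indep_vars (\<lambda>n. PiM (K n) (\<lambda>_. borel)) (\<lambda>n \<omega>. restrict (\<lambda>i. ?V i \<omega>) (K n)) UNIV"
    by (rule indep_vars_restrict[OF independent]) (auto simp: K_def disjoint_family_on_def)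
  then have "indep_vars (\<lambda>_. borel \<Otimes>\<^sub>M borel)
      (\<lambda>n \<omega>. (\<lambda>f. (f (Inr (Inl n)), f (Inr (Inr n)))) (restrict (\<lambda>i. ?V i \<omega>) (K n))) UNIV"
    by (rule indep_vars_compose2) (auto simp: K_def)
  then have "indep_vars (\<lambda>_. borel \<Otimes>\<^sub>M borel) (\<lambda>n \<omega>. marks \<omega> n) UNIV"
    by (simp add: K_def marks_def)
  then have "distr M (PiM UNIV (\<lambda>_. borel \<Otimes>\<^sub>M borel)) (\<lambda>\<omega>. \<lambda>n\<in>UNIV. marks \<omega> n) =
      PiM UNIV (\<lambda>n. distr M (borel \<Otimes>\<^sub>M borel) (\<lambda>\<omega>. marks \<omega> n))"
    by (subst (asm) indep_vars_iff_distr_eq_PiM) auto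
  moreover have "sets (PiM UNIV (\<lambda>_::int. borel \<Otimes>\<^sub>M borel)) = sets H.P0"
    unfolding H.P0_def by (rule sets_PiM_cong) simp_all
  ultimately have "distr M H.P0 marks =
      PiM UNIV (\<lambda>n. if n = 0 then density (F \<Otimes>\<^sub>M G) bias else F \<Otimes>\<^sub>M G)"
    by (simp add: distr_pair_marks restrict_def cong: distr_cong)
  also have "\<dots> = density H.P0 (\<lambda>p. bias (p 0))"
    by (rule H.density_PiM_coordinate[OF _ nn_integral_bias]) simp
  finally show ?thesis .
qed

text \<open>\<open>U\<close> has index \<open>Inl ()\<close>, while the marks are a function of the
  variables indexed by \<open>Inr\<close>; functions of disjoint groups of an independent family are
  independent.\<close>

lemma distr_U_marks:
  "distr M (borel \<Otimes>\<^sub>M H.P0) (\<lambda>\<omega>. (U \<omega>, marks \<omega>)) =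
    uniform_measure lborel {0..1} \<Otimes>\<^sub>M density H.P0 (\<lambda>p. bias (p 0))"
proof -
  let ?V = "case_sum (\<lambda>_::unit. U) (case_sum (\<lambda>n \<omega>. T (n + 1) \<omega> - T n \<omega>) S)"
  let ?A = "PiM {Inl ()} (\<lambda>_::unit + int + int. borel :: real measure)"
  let ?B = "PiM (range Inr) (\<lambda>_::unit + int + int. borel :: real measure)"
  let ?a = "\<lambda>\<omega>. restrict (\<lambda>i. ?V i \<omega>) {Inl ()}"
  let ?b = "\<lambda>\<omega>. restrict (\<lambda>i. ?V i \<omega>) (range Inr)"
  define h :: "(unit + int + int \<Rightarrow> real) \<Rightarrow> real" where "h f = f (Inl ())" for f
  define k :: "(unit + int + int \<Rightarrow> real) \<Rightarrow> int \<Rightarrow> real \<times> real"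
    where "k f n = (f (Inr (Inl n)), f (Inr (Inr n)))" for f n
  have [measurable]: "h \<in> measurable ?A borel" unfolding h_def by simp
  have [measurable]: "k \<in> measurable ?B H.P0"
    unfolding k_def by (rule H.measurable_into_P0) simp
  have "indep_var ?A ?a ?B ?b"
    by (rule indep_var_restrict[OF independent]) auto
  then have [measurable]: "?a \<in> measurable M ?A" "?b \<in> measurable M ?B"
    and ind: "distr M (?A \<Otimes>\<^sub>M ?B) (\<lambda>\<omega>. (?a \<omega>, ?b \<omega>)) = distr M ?A ?a \<Otimes>\<^sub>M distr M ?B ?b"
    unfolding indep_var_distribution_eq by simp_all
  have hk: "h (?a \<omega>) = U \<omega>" "k (?b \<omega>) = marks \<omega>" for \<omega>
    by (simp_all add: h_def k_def fun_eq_iff marks_def)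
  have "distr M (borel \<Otimes>\<^sub>M H.P0) (\<lambda>\<omega>. (U \<omega>, marks \<omega>)) =
      distr (distr M (?A \<Otimes>\<^sub>M ?B) (\<lambda>\<omega>. (?a \<omega>, ?b \<omega>))) (borel \<Otimes>\<^sub>M H.P0) (\<lambda>(x, y). (h x, k y))"
    by (subst distr_distr) (simp_all add: comp_def hk)
  also have "\<dots> = distr (distr M ?A ?a) borel h \<Otimes>\<^sub>M distr (distr M ?B ?b) H.P0 k"
    unfolding ind
  proof (rule pair_measure_distr[symmetric])
    show "sigma_finite_measure (distr (distr M ?B ?b) H.P0 k)"
      by (intro prob_space_imp_sigma_finite prob_space.prob_space_distr prob_space_distr) simp_all
  qed simp_all
  also have "distr (distr M ?A ?a) borel h = distr M borel U"
    by (subst distr_distr) (simp_all add: comp_def hk)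
  also have "distr (distr M ?B ?b) H.P0 k = distr M H.P0 marks"
    by (subst distr_distr) (simp_all add: comp_def hk)
  finally show ?thesis by (simp only: uniform distr_marks)
qed

text \<open>The time \<open>s\<close> is measured from the arrival of message 0. On a regular path
  exactly one term is selected; the form as a sum gives measurability and matches
  \<open>cycle_formula\<close>.\<close>

definition age_at :: "real \<Rightarrow> (int \<Rightarrow> real \<times> real) \<Rightarrow> ennreal" where
  "age_at s p = (\<integral>\<^sup>+n. (if arrival p n \<le> s \<and> s < arrival p (n + 1)
     then age_since_arrival (s - arrival p n) (shift n p) else 0) \<partial>count_space UNIV)"

lemma measurable_age_at [measurable]: "(\<lambda>(s, p). age_at s p) \<in> borel_measurable (borel \<Otimes>\<^sub>M H.P0)"
  unfolding age_at_def split_beta by (rule borel_measurable_nn_integral_count_space) measurable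

text \<open>Since \<open>T 0 \<omega> = - U \<omega> * (T 1 \<omega> - T 0 \<omega>)\<close> almost
  surely, time \<open>t\<close> is \<open>t + U \<omega> * fst (marks \<omega> 0)\<close> on the
  clock that starts with message 0.\<close>

lemma AE_relative_age:
  "AE \<omega> in M. 0 \<le> relative_age (\<lambda>n. T n \<omega>) (\<lambda>n. S n \<omega>) t \<and>
    ennreal (relative_age (\<lambda>n. T n \<omega>) (\<lambda>n. S n \<omega>) t) = age_at (t + U \<omega> * fst (marks \<omega> 0)) (marks \<omega>)"
proof -
  \<comment> \<open>Regularity passes from the Palm law to the stationary law, which has a density
    with respect to it.\<close>
  have "AE p in distr M H.P0 marks. regular p"
    unfolding distr_marks
  proof (rule iffD2[OF AE_density])
    show "(\<lambda>p. bias (p 0)) \<in> borel_measurable H.P0" by measurable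
    show "AE p in H.P0. 0 < bias (p 0) \<longrightarrow> regular p"
      using H.AE_regular by eventually_elim simp
  qed
  then have "AE \<omega> in M. regular (marks \<omega>)"
    by (rule AE_distrD[OF measurable_marks])
  then show ?thesis using first_arrival
  proof eventually_elim
    case (elim \<omega>)
    define s where "s = t + U \<omega> * fst (marks \<omega> 0)"
    have T: "T n \<omega> = t - s + arrival (marks \<omega>) n" for n
      using arrival_eq[of "marks \<omega>" "\<lambda>n. T n \<omega>" n] elim(2) by (simp add: s_def marks_def)
    note ex1 = arrival_intervals_cover[OF elim(1), of s]
    from ex1_implies_ex[OF ex1]
    obtain m where m: "arrival (marks \<omega>) m \<le> s \<and> s < arrival (marks \<omega>) (m + 1)"
      by (rule exE)
    have "age_at s (marks \<omega>) = age_since_arrival (s - arrival (marks \<omega>) m) (shift m (marks \<omega>))"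
      unfolding age_at_def by (rule nn_integral_count_space_unique[OF ex1 m])
    also have "s - arrival (marks \<omega>) m = t - T m \<omega>" using T[of m] by simp
    finally have age: "age_at s (marks \<omega>) = age_since_arrival (t - T m \<omega>) (shift m (marks \<omega>))" .
    have eq: "marks \<omega> k = (T (k + 1) \<omega> - T k \<omega>, S k \<omega>)" for k by (simp add: marks_def)
    have regular: "T k \<omega> < T (k + 1) \<omega>" "0 < S k \<omega>" for k
      using elim(1) by (simp_all add: regular_def marks_def)
    have success: "\<exists>k<m. transmitted (\<lambda>n. T n \<omega>) (\<lambda>n. S n \<omega>) k"
      using elim(1) unfolding regular_def transmitted_def marks_def fst_conv snd_conv by blast
    have m': "T m \<omega> \<le> t" "t < T (m + 1) \<omega>"
      using m T[of m] T[of "m + 1"] by linarith+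
    note age_eq = relative_age_eq[of "marks \<omega>" "\<lambda>n. T n \<omega>" "\<lambda>n. S n \<omega>" m t, OF eq regular m' success]
    show ?case using age_eq age by (simp add: s_def)
  qed
qed

text \<open>The length bias \<open>y\<close> is the Jacobian of \<open>v = u * y\<close>: a uniform
  point weighted by the cycle length is Lebesgue measure on the cycle.\<close>

lemma nn_integral_uniform_scaled:
  assumes [measurable]: "f \<in> borel_measurable borel" and y: "0 < y"
  shows "ennreal y * (\<integral>\<^sup>+u. f (u * y) \<partial>uniform_measure lborel {0..1}) =
    (\<integral>\<^sup>+v. (if 0 \<le> v \<and> v < y then f v else 0) \<partial>lborel)"
proof -
  have "(\<integral>\<^sup>+u. f (u * y) \<partial>uniform_measure lborel {0..1}) = (\<integral>\<^sup>+u. f (u * y) * indicator {0..1} u \<partial>lborel)"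
    by (subst nn_integral_uniform_measure) (simp_all add: divide_ennreal_def)
  also have "\<dots> = (\<integral>\<^sup>+u. (if 0 \<le> 0 + y * u \<and> 0 + y * u < y then f (0 + y * u) else 0) \<partial>lborel)"
  \<comment> \<open>The point 1 separates the closed unit interval from the half-open cycle and is a
    null set.\<close>
  proof (rule nn_integral_cong_AE, rule AE_mp[OF AE_lborel_singleton[of 1]], rule AE_I2, rule impI)
    fix u :: real assume "u \<noteq> 1"
    moreover have "0 \<le> y * u \<longleftrightarrow> 0 \<le> u" "y * u < y \<longleftrightarrow> u < 1"
      using y by (simp_all add: zero_le_mult_iff)
    ultimately show "f (u * y) * indicator {0..1} u =
        (if 0 \<le> 0 + y * u \<and> 0 + y * u < y then f (0 + y * u) else 0)"
      by (simp add: indicator_def mult.commute[of u y] less_le)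
  qed
  also have "ennreal y * \<dots> = (\<integral>\<^sup>+v. (if 0 \<le> v \<and> v < y then f v else 0) \<partial>lborel)"
    using y nn_integral_real_affine[of "\<lambda>v. if 0 \<le> v \<and> v < y then f v else 0" y 0] by simp
  finally show ?thesis .
qed

lemma nn_integral_relative_age:
  "(\<integral>\<^sup>+\<omega>. ennreal (relative_age (\<lambda>n. T n \<omega>) (\<lambda>n. S n \<omega>) t) \<partial>M) =
    ennreal ((\<integral>x. min (fst x) (snd x) \<partial>(F \<Otimes>\<^sub>M G)) / measure (F \<Otimes>\<^sub>M G) {x. snd x < fst x})"
proof -
  let ?Q = "density H.P0 (\<lambda>p::int \<Rightarrow> real \<times> real. bias (p 0))" and ?u = "uniform_measure lborel {0..1::real}"
  have prob_Q: "prob_space ?Q" unfolding distr_marks[symmetric] by (rule prob_space_distr) simp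
  have prob_u: "prob_space ?u" by (rule prob_space_uniform_measure) auto
  interpret uQ: pair_prob_space ?u ?Q
    by (intro pair_prob_space.intro pair_sigma_finite.intro prob_space_imp_sigma_finite prob_Q prob_u)
  have "(\<integral>\<^sup>+\<omega>. ennreal (relative_age (\<lambda>n. T n \<omega>) (\<lambda>n. S n \<omega>) t) \<partial>M) =
      (\<integral>\<^sup>+\<omega>. (\<lambda>(u, p). age_at (t + u * fst (p 0)) p) (U \<omega>, marks \<omega>) \<partial>M)"
    by (rule nn_integral_cong_AE) (use AE_relative_age[of t] in auto)
  also have "\<dots> = (\<integral>\<^sup>+x. (\<lambda>(u, p). age_at (t + u * fst (p 0)) p) x \<partial>(?u \<Otimes>\<^sub>M ?Q))"
    unfolding distr_U_marks[symmetric] by (subst nn_integral_distr) simp_all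
  also have "\<dots> = (\<integral>\<^sup>+p. \<integral>\<^sup>+u. age_at (t + u * fst (p 0)) p \<partial>?u \<partial>?Q)"
    by (subst uQ.nn_integral_snd[symmetric]) simp_all
  also have "\<dots> = (\<integral>\<^sup>+p. bias (p 0) * (\<integral>\<^sup>+u. age_at (t + u * fst (p 0)) p \<partial>?u) \<partial>H.P0)"
    by (subst nn_integral_density) simp_all
  \<comment> \<open>The factor \<open>fst (p 0)\<close> of \<open>bias\<close> is absorbed by the
    change of variable, and \<open>1 / mean\<close> remains.\<close>
  also have "\<dots> = (\<integral>\<^sup>+p. ennreal (1 / mean) *
      (\<integral>\<^sup>+v. (if 0 \<le> v \<and> v < fst (p 0) then age_at (t + v) p else 0) \<partial>lborel) \<partial>H.P0)"
  proof (rule nn_integral_cong_AE, rule AE_mp[OF H.AE_coordinate[OF H.pos, of 0]], rule AE_I2, rule impI)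
    fix p :: "int \<Rightarrow> real \<times> real" assume p: "0 < fst (p 0) \<and> 0 < snd (p 0)"
    have "bias (p 0) = ennreal (1 / mean) * ennreal (fst (p 0))"
      using mean_pos p by (simp flip: ennreal_mult')
    then show "bias (p 0) * (\<integral>\<^sup>+u. age_at (t + u * fst (p 0)) p \<partial>?u) = ennreal (1 / mean) *
        (\<integral>\<^sup>+v. (if 0 \<le> v \<and> v < fst (p 0) then age_at (t + v) p else 0) \<partial>lborel)"
      using p nn_integral_uniform_scaled[of "\<lambda>v. age_at (t + v) p" "fst (p 0)"] by (simp add: mult.assoc)
  qed
  also have "\<dots> = ennreal (1 / mean) * (\<integral>\<^sup>+p.
      (\<integral>\<^sup>+v. (if 0 \<le> v \<and> v < fst (p 0) then age_at (t + v) p else 0) \<partial>lborel) \<partial>H.P0)"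
    by (rule nn_integral_cmult) measurable
  \<comment> \<open>Here \<open>t\<close> disappears. The age over a cycle has a factor
    \<open>mean\<close>, from the counted interarrival times, which cancels the normalisation of the
    length bias.\<close>
  also have "\<dots> = ennreal (1 / mean) *
      ennreal ((\<integral>x. min (fst x) (snd x) \<partial>(F \<Otimes>\<^sub>M G)) * mean / measure (F \<Otimes>\<^sub>M G) {x. snd x < fst x})"
    by (simp only: age_at_def H.cycle_formula[OF H.measurable_age_since_arrival]
        H.nn_integral_age_over_cycle mean_eq)
  also have "\<dots> = ennreal ((\<integral>x. min (fst x) (snd x) \<partial>(F \<Otimes>\<^sub>M G)) / measure (F \<Otimes>\<^sub>M G) {x. snd x < fst x})"
    using mean_pos by (simp flip: ennreal_mult')
  finally show ?thesis .
qed

lemma expected_relative_age: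
  "integrable M (\<lambda>\<omega>. relative_age (\<lambda>n. T n \<omega>) (\<lambda>n. S n \<omega>) t) \<and>
    (\<integral>\<omega>. relative_age (\<lambda>n. T n \<omega>) (\<lambda>n. S n \<omega>) t \<partial>M) =
      (\<integral>x. min (fst x) (snd x) \<partial>(F \<Otimes>\<^sub>M G)) / measure (F \<Otimes>\<^sub>M G) {x. snd x < fst x}"
proof -
  have "(\<lambda>\<omega>. relative_age (\<lambda>n. T n \<omega>) (\<lambda>n. S n \<omega>) t) \<in> borel_measurable M"
    by (rule borel_measurable_relative_age) measurable
  moreover have "AE \<omega> in M. 0 \<le> relative_age (\<lambda>n. T n \<omega>) (\<lambda>n. S n \<omega>) t"
    using AE_relative_age[of t] by eventually_elim simp
  moreover have "0 \<le> (\<integral>x. min (fst x) (snd x) \<partial>(F \<Otimes>\<^sub>M G)) / measure (F \<Otimes>\<^sub>M G) {x. snd x < fst x}"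
  proof (intro divide_nonneg_nonneg integral_nonneg_AE measure_nonneg)
    show "AE x in F \<Otimes>\<^sub>M G. 0 \<le> min (fst x) (snd x)"
      using H.pos by eventually_elim simp
  qed
  ultimately show ?thesis
    using nn_integral_relative_age[of t] nn_integral_eq_integrable by blast
qed

end

section \<open>Transfer from the marginal laws to the random variables \<open>X\<close> and
  \<open>S\<close>\<close>

theorem mainTheorem1:
  fixes N :: "'b measure" and X S :: "'b \<Rightarrow> real"
    and M :: "'a measure" and T \<sigma> :: "int \<Rightarrow> 'a \<Rightarrow> real" and U :: "'a \<Rightarrow> real"
    and t :: real
  assumes "prob_space N"
    and "prob_space.indep_var N borel X borel S"
    and "\<P>(\<omega> in N. X \<omega> > 0) = 1" and "\<P>(\<omega> in N. S \<omega> > 0) = 1"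
    and "integrable N X" and "0 < (\<integral>\<omega>. X \<omega> \<partial>N)"
    and "integrable N S" and "0 < (\<integral>\<omega>. S \<omega> \<partial>N)"
    and "\<P>(\<omega> in N. X \<omega> > S \<omega>) > 0"
    and "stationary_push_out_server M (distr N borel X) (distr N borel S) T \<sigma> U"
  shows "integrable M (\<lambda>\<omega>. relative_age (\<lambda>n. T n \<omega>) (\<lambda>n. \<sigma> n \<omega>) t) \<and>
    (\<integral>\<omega>. relative_age (\<lambda>n. T n \<omega>) (\<lambda>n. \<sigma> n \<omega>) t \<partial>M) =
      (\<integral>\<omega>. min (X \<omega>) (S \<omega>) \<partial>N) / \<P>(\<omega> in N. X \<omega> > S \<omega>)"
proof -
  interpret N: prob_space N by fact
  have [measurable]: "X \<in> borel_measurable N" "S \<in> borel_measurable N"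
    using assms(5,7) by auto
  \<comment> \<open>Independence identifies the law of one pair under the Palm measure with the
    joint law of \<open>X\<close> and \<open>S\<close>; the hypotheses and both integrals are
    transported along this equality.\<close>
  have H: "distr N borel X \<Otimes>\<^sub>M distr N borel S = distr N (borel \<Otimes>\<^sub>M borel) (\<lambda>\<omega>. (X \<omega>, S \<omega>))"
    using assms(2) unfolding N.indep_var_distribution_eq by auto
  have [measurable]: "{x. snd x < fst x} \<in> sets (borel \<Otimes>\<^sub>M borel :: (real \<times> real) measure)"
    by (rule sets_Collect_UNIV) (simp_all add: space_pair_measure)
  have success: "measure (distr N borel X \<Otimes>\<^sub>M distr N borel S) {x. snd x < fst x} =
      \<P>(\<omega> in N. X \<omega> > S \<omega>)"
    unfolding H by (subst measure_distr) (auto intro!: arg_cong[where f="measure N"])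
  have "palm (distr N borel X \<Otimes>\<^sub>M distr N borel S)"
  proof (intro palm.intro palm_axioms.intro)
    show "prob_space (distr N borel X \<Otimes>\<^sub>M distr N borel S)"
      unfolding H by (rule N.prob_space_distr) simp
    show "AE x in distr N borel X \<Otimes>\<^sub>M distr N borel S. 0 < fst x \<and> 0 < snd x"
      unfolding H using N.prob_Collect_eq_1[of "\<lambda>\<omega>. 0 < X \<omega>"] N.prob_Collect_eq_1[of "\<lambda>\<omega>. 0 < S \<omega>"]
        assms(3,4) by (subst AE_distr_iff) auto
    show "integrable (distr N borel X \<Otimes>\<^sub>M distr N borel S) fst"
      unfolding H using assms(5) by (subst integrable_distr_eq) auto
    show "0 < measure (distr N borel X \<Otimes>\<^sub>M distr N borel S) {x. snd x < fst x}"
      using assms(9) success by simp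
  qed simp
  then interpret regular_push_out_server M "distr N borel X" "distr N borel S" T \<sigma> U
    using assms(10) by (intro regular_push_out_server.intro)
  have "(\<integral>x. min (fst x) (snd x) \<partial>(distr N borel X \<Otimes>\<^sub>M distr N borel S)) = (\<integral>\<omega>. min (X \<omega>) (S \<omega>) \<partial>N)"
    unfolding H by (subst integral_distr) auto
  then show ?thesis using expected_relative_age[of t] by (simp only: success)
qed

end
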